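(* Let $\mathbb{F}$ be an arbitrary field and $A\in\mathbb{F}^{m\times n}$. Let $I\subset\{1,\dots,m\}$, $J\subset\{1,\dots,n\}$, $C=A(:,J)$, $R=A(I,:)$, and $U=A(I,J)$. Assume that one of the following (equivalent) conditions holds: (a) $\operatorname{rank}(U)=\operatorname{rank}(A)$; (b) $\operatorname{rank}(C)=\operatorname{rank}(R)=\operatorname{rank}(A)$; (c) $A=CU^\sim R$ for some (equivalently, all) generalized inverses $U^\sim$ of $U$; (d) $A=CC^\sim AR^\sim R$ for some (equivalently, all) generalized inverses $C^\sim$ of $C$ and $R^\sim$ of $R$; (e) $R^\sim UC^\sim$ is a generalized inverse of $A$ for some (equivalently, all) generalized inverses $C^\sim$ of $C$ and $R^\sim$ of $R$; (f) with $B=A(I,J^c)$, $D=A(I^c,J)$, $E=A(I^c,J^c)$, one has $E-DU^\sim B=0$, $D(\mathrm{Id}-U^\sim U)=0$ and $(\mathrm{Id}-UU^\sim)B=0$ for some (equivalently, all) generalized inverses $U^\sim$ of $U$. Then: (i) for every generalized inverse $C^\sim$ of $C$ and every generalized inverse $R^\sim$ of $R$, $X=R^\sim UC^\sim$ is a $\{1,2\}$-inverse of $A$, i.e. $AXA=A$ and $XAX=X$; (ii) if a generalized inverse $C^\sim$ of $C$ satisfies $(CC^\sim)^*=CC^\sim$, then for any generalized inverse $R^\sim$ of $R$, $X=R^\sim UC^\sim$ satisfies $(AX)^*=AX$; (iii) if a generalized inverse $R^\sim$ of $R$ satisfies $(R^\sim R)^*=R^\sim R$, then for any generalized inverse $C^\sim$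 of $C$, $X=R^\sim UC^\sim$ satisfies $(XA)^*=XA$.
   Context: For $A\in\mathbb{F}^{m\times n}$ and index sets $I,J$: $A(I,:)$ is the submatrix of rows indexed by $I$, $A(:,J)$ the submatrix of columns indexed by $J$, and $A(I,J)$ the submatrix of entries with row index in $I$ and column index in $J$; $I^c$, $J^c$ are complements in $\{1,\dots,m\}$ and $\{1,\dots,n\}$; $\mathrm{Id}$ is an identity matrix of appropriate size. A generalized inverse of a matrix $M\in\mathbb{F}^{p\times q}$ is any $M^\sim\in\mathbb{F}^{q\times p}$ with $MM^\sim M=M$. The operation $^*$ is the conjugate transpose if $\mathbb{F}=\mathbb{C}$ and the transpose for other fields. *)

theory Defs
  imports
    "Jordan_Normal_Form.DL_Rank"
    "Jordan_Normal_Form.DL_Submatrix"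
    "Jordan_Normal_Form.Schur_Decomposition"
begin

(* Row and column indices start at 0, so the index sets {1..m} and {1..n} become {..<m} and {..<n}.
   The slice ":" is rendered by UNIV, since submatrix only uses the indices that are in range.
   The operation * is conjugate transposition over the complex numbers and transposition over other
   fields.  Since it depends on the type of the entries, claims about it are stated twice: with
   transpose_mat over an arbitrary field and with mat_adjoint over the complex numbers. *)

(* The first argument of vec_space.rank is the dimension of the column vectors. *)
abbreviation mat_rank :: "'a::field mat \<Rightarrow> nat" where
  "mat_rank M \<equiv> vec_space.rank (dim_row M) M"

definition ginverses :: "'a::field mat \<Rightarrow> 'a mat set" where
  "ginverses M = {G \<in> carrier_mat (dim_col M) (dim_row M). M * G * M = M}"

(* Every condition that mentions generalized inverses is listed twice, first in its "for some" and
   then in its "for all" form.  K ranges over generalized inverses of C, L over those of R and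
   G over those of U; Ic and Jc are the complements of I and J. *)
definition cur_conditions :: "'a::field mat \<Rightarrow> nat set \<Rightarrow> nat set \<Rightarrow> bool list" where
  "cur_conditions A I J =
    (let Ic = {..<dim_row A} - I;
         Jc = {..<dim_col A} - J;
         C = submatrix A UNIV J;
         R = submatrix A I UNIV;
         U = submatrix A I J;
         B = submatrix A I Jc;
         D = submatrix A Ic J;
         E = submatrix A Ic Jc;
         schur = (\<lambda>G. E - D * G * B = 0\<^sub>m (dim_row E) (dim_col E)
                   \<and> D * (1\<^sub>m (dim_col U) - G * U) = 0\<^sub>m (dim_row D) (dim_col D)
                   \<and> (1\<^sub>m (dim_row U) - U * G) * B = 0\<^sub>m (dim_row B) (dim_col B))
     in [mat_rank U = mat_rank A,
         mat_rank C = mat_rank A \<and> mat_rank R = mat_rank A,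
         \<exists>G \<in> ginverses U. A = C * G * R,
         \<forall>G \<in> ginverses U. A = C * G * R,
         \<exists>K \<in> ginverses C. \<exists>L \<in> ginverses R. A = C * K * A * L * R,
         \<forall>K \<in> ginverses C. \<forall>L \<in> ginverses R. A = C * K * A * L * R,
         \<exists>K \<in> ginverses C. \<exists>L \<in> ginverses R. L * U * K \<in> ginverses A,
         \<forall>K \<in> ginverses C. \<forall>L \<in> ginverses R. L * U * K \<in> ginverses A,
         \<exists>G \<in> ginverses U. schur G,
         \<forall>G \<in> ginverses U. schur G])"

end

theory Submission
  imports Defs
begin

text \<open>
  All conditions say the same thing: the chosen columns span the column space of \<open>A\<close> and the chosen
  rows span its row space, that is, \<open>A = C * Y\<close> and \<open>A = X * R\<close> for some \<open>X\<close> and \<open>Y\<close>.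
  Writing \<open>C = A * Q\<close>, \<open>R = P * A\<close> and \<open>U = P * A * Q\<close> with selection matrices \<open>P\<close> and \<open>Q\<close>, this gives
  \<open>A = X * U * Y\<close>, since \<open>X * U * Y = (X * P * A) * Q * Y = A * Q * Y = A\<close>. As these are arguments about
  products, the locale \<open>cur_selection\<close> treats all conditions except the one on blocks, and the
  claims about \<open>L * U * K\<close>, for arbitrary \<open>P\<close> and \<open>Q\<close>.

  From the spanning property, a generalized inverse in the middle can always be cancelled:
  \<open>C * K * A = C * K * C * Y = A\<close>, likewise \<open>A * L * R = A\<close>, and
  \<open>C * G * R = X * U * G * U * Y = A\<close>. Conversely, every factorization in these conditions starts with
  \<open>C\<close> and ends with \<open>R\<close>, or bounds the rank of \<open>A\<close> by that of \<open>U\<close>. The ranks are compared through full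
  rank factorizations: the rank is the least inner dimension of a factorization, which makes it
  invariant under transposition and monotone under products, and if \<open>A * Q\<close> has the rank of
  \<open>A = F * G\<close>, then \<open>G * Q\<close> has a right inverse \<open>Z\<close>, so that \<open>A = A * Q * (Z * G)\<close>. Full rank
  factorizations also provide generalized inverses, which is what passes from the versions of the
  conditions for all generalized inverses to those for some. The block condition for a given \<open>G\<close> is
  \<open>A = C * G * R\<close> read off block by block; its \<open>U\<close>-block is \<open>U = U * G * U\<close>.

  The two cancellation rules also give \<open>A * (L * U * K) = A * L * R * Q * K = C * K\<close> and
  \<open>(L * U * K) * A = L * P * (C * K * A) = L * R\<close>. So the projections belonging to the inverse of \<open>A\<close> are
  literally those of \<open>C\<close> and \<open>R\<close>, and they are symmetric, or Hermitian, together with them.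
\<close>

section \<open>Rank factorizations\<close>

text \<open>With equations between dimensions as premises, instead of membership in carriers whose dimensions
  have to be guessed, associativity can serve as a rewrite rule.\<close>

lemma mult_mat_assoc:
  fixes A B C :: "'a::semiring_0 mat"
  shows "dim_col A = dim_row B \<Longrightarrow> dim_col B = dim_row C \<Longrightarrow> A * B * C = A * (B * C)"
  by (rule assoc_mult_mat[of _ "dim_row A" "dim_col A" _ "dim_col B" _ "dim_col C"]) auto

context vec_space
begin

lemma exists_factor_through_cols:
  assumes F: "F \<in> carrier_mat n r" and A: "A \<in> carrier_mat n c"
    and in_span: "set (cols A) \<subseteq> span (set (cols F))"
  shows "\<exists>G \<in> carrier_mat r c. A = F * G"
proof -
  have "\<exists>x. x \<in> carrier_vec r \<and> F *\<^sub>v x = col A j" if "j < c" for j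
  proof -
    have "col A j \<in> set (cols A)"
      using that A by (metis carrier_matD(2) cols_length cols_nth nth_mem)
    then have "col A j \<in> col_space F"
      using in_span unfolding col_space_def by blast
    then show ?thesis
      using F unfolding col_space_eq[OF F] by auto
  qed
  then obtain x where x: "\<And>j. j < c \<Longrightarrow> x j \<in> carrier_vec r \<and> F *\<^sub>v x j = col A j"
    by metis
  define G where "G = mat_of_cols r (map x [0..<c])"
  have G: "G \<in> carrier_mat r c"
    unfolding G_def by (simp add: mat_of_cols_def)
  have "A = F * G"
  proof (rule mat_col_eqI)
    fix j assume "j < dim_col (F * G)"
    then have j: "j < c" using G by simp
    have "col G j = x j"
      unfolding G_def using j x[OF j] by (subst col_mat_of_cols) auto
    then show "col A j = col (F * G) j"
      using x[OF j] by (simp only: col_mult2[OF F G j])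
  qed (use A F G in auto)
  with G show ?thesis by blast
qed

text \<open>A maximal independent set of columns spans all columns, since a column outside its span could be
  added to it.\<close>

lemma exists_column_basis:
  assumes A: "A \<in> carrier_mat n c"
  obtains F where "F \<in> carrier_mat n (rank A)" "distinct (cols F)" "lin_indpt (set (cols F))"
    "set (cols F) \<subseteq> set (cols A)" "set (cols A) \<subseteq> span (set (cols F))"
proof -
  have cA: "set (cols A) \<subseteq> carrier_vec n" using A cols_dim by blast
  have "lin_indpt {}"
    by (simp add: lin_dep_def)
  then obtain S where max: "maximal S (\<lambda>T. T \<subseteq> set (cols A) \<and> lin_indpt T)"
    using maximal_exists_superset[of "set (cols A)" "\<lambda>T. T \<subseteq> set (cols A) \<and> lin_indpt T" "{}"]
    by auto
  then have S: "S \<subseteq> set (cols A)" "lin_indpt S" by (auto simp: maximal_def)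
  then have cS: "S \<subseteq> carrier_vec n" using cA by blast
  have "set (cols A) \<subseteq> span S"
  proof
    fix v assume v: "v \<in> set (cols A)"
    show "v \<in> span S"
    proof (rule ccontr)
      assume nv: "v \<notin> span S"
      then have "v \<notin> S" using cS by (auto intro: span_mem)
      moreover have "lin_indpt (S \<union> {v})"
        using lin_dep_iff_in_span[of S v] S cS nv v cA \<open>v \<notin> S\<close> by auto
      ultimately show False
        using max v S unfolding maximal_def by blast
    qed
  qed
  moreover obtain ws where ws: "set ws = S" "distinct ws"
    using S(1) finite_distinct_list finite_subset by (metis List.finite_set)
  moreover have "length ws = rank A"
    using rank_card_indpt[OF A max] ws distinct_card by metis
  moreover have "cols (mat_of_cols n ws) = ws"
    using ws cS by (simp add: cols_mat_of_cols)
  ultimately show ?thesis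
    using S by (intro that[of "mat_of_cols n ws"]) (auto simp: mat_of_cols_def)
qed

lemma exists_rank_factorization:
  assumes A: "A \<in> carrier_mat n c"
  shows "\<exists>F \<in> carrier_mat n (rank A). \<exists>G \<in> carrier_mat (rank A) c. A = F * G"
proof -
  obtain F where "F \<in> carrier_mat n (rank A)" "set (cols A) \<subseteq> span (set (cols F))"
    using exists_column_basis[OF A] .
  then show ?thesis
    using exists_factor_through_cols[OF _ A] by blast
qed

text \<open>The columns of the product lie in the column space of the left factor, and a matrix with
  \<open>r\<close> columns has rank at most \<open>r\<close>.\<close>

lemma rank_mult_le_inner_dim:
  assumes X: "X \<in> carrier_mat n r" and Y: "Y \<in> carrier_mat r c"
  shows "rank (X * Y) \<le> r"
proof -
  have cX: "set (cols X) \<subseteq> carrier_vec n" using X cols_dim by blast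
  have XY: "X * Y \<in> carrier_mat n c" using X Y by simp
  have cXY: "set (cols (X * Y)) \<subseteq> carrier_vec n" using XY cols_dim by blast
  have "set (cols (X * Y)) \<subseteq> span (set (cols X))"
  proof
    fix v assume "v \<in> set (cols (X * Y))"
    then obtain j where j: "j < c" and v: "v = col (X * Y) j"
      using XY by (auto simp: cols_def)
    have "v = X *\<^sub>v col Y j" using v col_mult2[OF X Y j] by simp
    then have "v \<in> col_space X"
      unfolding col_space_eq[OF X] using X Y j by auto
    then show "v \<in> span (set (cols X))" by (simp add: col_space_def)
  qed
  then have le: "span (set (cols (X * Y))) \<subseteq> span (set (cols X))"
    using span_is_subset span_is_submodule[of "set (cols X)"] cX by simp
  have sX: "VectorSpace.subspace class_ring (span (set (cols X))) V"
    using cX span_is_subspace by simp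
  have sXY: "VectorSpace.subspace class_ring (span (set (cols (X * Y)))) V"
    using cXY span_is_subspace by simp
  have "rank (X * Y) \<le> rank X"
    unfolding rank_def
    using vectorspace.subspace_dim[OF subspace_is_vs[OF sX] nested_subspaces[OF sX sXY le]
        fin_dim_span_cols[OF X]] fin_dim_span_cols[OF XY] by simp
  also have "\<dots> \<le> r" using rank_le_nc[OF X] .
  finally show ?thesis .
qed

text \<open>A basis of the column space then has \<open>n\<close> elements, hence is a basis of the whole space, and so
  the unit vectors are combinations of columns of \<open>N\<close>.\<close>

lemma full_row_rank_imp_right_inverse:
  assumes N: "N \<in> carrier_mat n c" and full: "rank N = n"
  shows "\<exists>Z \<in> carrier_mat c n. N * Z = 1\<^sub>m n"
proof -
  obtain F where F: "F \<in> carrier_mat n n" "distinct (cols F)" "lin_indpt (set (cols F))"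
    "set (cols F) \<subseteq> set (cols N)"
    using exists_column_basis[OF N] full by metis
  have cN: "set (cols N) \<subseteq> carrier_vec n" using N cols_dim by blast
  have "card (set (cols F)) = n"
    using F by (simp add: distinct_card)
  then have "basis (set (cols F))"
    using F cN by (intro dim_li_is_basis) (auto simp: dim_is_n)
  then have "carrier_vec n \<subseteq> span (set (cols N))"
    using span_is_monotone[OF F(4)] by (auto simp: basis_def)
  moreover have "set (cols (1\<^sub>m n)) \<subseteq> (carrier_vec n :: 'a vec set)"
    using cols_dim[of "1\<^sub>m n"] by simp
  ultimately show ?thesis
    using exists_factor_through_cols[OF N, of "1\<^sub>m n" n] by (metis one_carrier_mat subset_trans)
qed

end

text \<open>The next two lemmas together say that the rank is the least inner dimension of a factorization.
  In this form the behaviour of ranks under products and transposition is immediate.\<close>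

lemma mat_rank_factorization:
  obtains F G where "F \<in> carrier_mat (dim_row A) (mat_rank A)"
    "G \<in> carrier_mat (mat_rank A) (dim_col A)"
    "F * G = A"
proof -
  have "A \<in> carrier_mat (dim_row A) (dim_col A)" by simp
  from vec_space.exists_rank_factorization[OF this] show ?thesis
    by (elim bexE) (rule that[OF _ _ sym])
qed

lemma mat_rank_mult_le_inner_dim:
  assumes "dim_col X = dim_row Y"
  shows "mat_rank (X * Y) \<le> dim_col X"
  unfolding index_mult_mat
  by (rule vec_space.rank_mult_le_inner_dim[of _ _ _ _ "dim_col Y"])
    (auto intro: carrier_matI assms[symmetric])

lemma mat_rank_mult_le_left:
  assumes "dim_col X = dim_row Y"
  shows "mat_rank (X * Y) \<le> mat_rank X"
proof -
  obtain F G where FG: "F \<in> carrier_mat (dim_row X) (mat_rank X)"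
      "G \<in> carrier_mat (mat_rank X) (dim_col X)" "F * G = X"
    by (rule mat_rank_factorization)
  have "F * G * Y = F * (G * Y)"
    using FG(1,2) assms by (intro mult_mat_assoc) auto
  then have "X * Y = F * (G * Y)"
    using FG(3) by simp
  then show ?thesis
    using mat_rank_mult_le_inner_dim[of F "G * Y"] FG(1,2) by simp
qed

lemma mat_rank_transpose_le: "mat_rank (transpose_mat A) \<le> mat_rank A"
proof -
  obtain F G where FG: "F \<in> carrier_mat (dim_row A) (mat_rank A)"
      "G \<in> carrier_mat (mat_rank A) (dim_col A)" "F * G = A"
    by (rule mat_rank_factorization)
  have "transpose_mat A = transpose_mat G * transpose_mat F"
    using transpose_mult[OF FG(1,2)] FG(3) by simp
  then show ?thesis
    using mat_rank_mult_le_inner_dim[of "transpose_mat G" "transpose_mat F"] FG(1,2) by simp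
qed

lemma mat_rank_transpose: "mat_rank (transpose_mat A) = mat_rank A"
  using mat_rank_transpose_le[of A] mat_rank_transpose_le[of "transpose_mat A"] by simp

lemma transpose_mult_dim:
  fixes X Y :: "'a::comm_semiring_0 mat"
  shows "dim_col X = dim_row Y \<Longrightarrow>
    transpose_mat (X * Y) = transpose_mat Y * transpose_mat X"
  by (rule transpose_mult[of _ "dim_row X" "dim_col X" _ "dim_col Y"]) auto

lemma mat_rank_mult_le_right:
  assumes "dim_col X = dim_row Y"
  shows "mat_rank (X * Y) \<le> mat_rank Y"
  using mat_rank_mult_le_left[of "transpose_mat Y" "transpose_mat X"] assms mat_rank_transpose[of Y]
    mat_rank_transpose[of "X * Y"]
  by (simp add: transpose_mult_dim)

lemma exists_right_inverse:
  assumes "mat_rank N = dim_row N"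
  obtains Z where "Z \<in> carrier_mat (dim_col N) (dim_row N)" "N * Z = 1\<^sub>m (dim_row N)"
  using vec_space.full_row_rank_imp_right_inverse[of N "dim_row N" "dim_col N"] assms by auto

lemma exists_left_inverse:
  assumes "mat_rank N = dim_col N"
  obtains Z where "Z \<in> carrier_mat (dim_col N) (dim_row N)" "Z * N = 1\<^sub>m (dim_col N)"
proof -
  obtain Z where Z: "Z \<in> carrier_mat (dim_row N) (dim_col N)"
      "transpose_mat N * Z = 1\<^sub>m (dim_col N)"
    using exists_right_inverse[of "transpose_mat N"] assms mat_rank_transpose[of N] by auto
  then have "transpose_mat Z * N = 1\<^sub>m (dim_col N)"
    using transpose_mult_dim[of "transpose_mat N" Z] by simp
  then show ?thesis using Z(1) by (intro that[of "transpose_mat Z"]) auto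
qed

text \<open>In a full rank factorization \<open>A = F * G\<close>, the product of a right inverse of \<open>G\<close> and a left
  inverse of \<open>F\<close> is a generalized inverse of \<open>A\<close>.\<close>

lemma ginverses_nonempty: "ginverses A \<noteq> {}"
proof -
  define r m n where "r = mat_rank A" and "m = dim_row A" and "n = dim_col A"
  obtain F G where F: "F \<in> carrier_mat m r" and G: "G \<in> carrier_mat r n" and FG: "F * G = A"
    using mat_rank_factorization[of A] unfolding r_def m_def n_def by metis
  have "r \<le> mat_rank F" "r \<le> mat_rank G"
    using mat_rank_mult_le_left[of F G] mat_rank_mult_le_right[of F G] F G FG r_def by auto
  moreover have "mat_rank F \<le> r"
    using mat_rank_mult_le_inner_dim[of F "1\<^sub>m r"] F by simp
  moreover have "mat_rank G \<le> r"
    using mat_rank_mult_le_inner_dim[of "1\<^sub>m r" G] G by simp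
  ultimately have r: "mat_rank F = dim_col F" "mat_rank G = dim_row G"
    using F G by auto
  obtain F' where F': "F' \<in> carrier_mat r m" "F' * F = 1\<^sub>m r"
    using exists_left_inverse[OF r(1)] F by auto
  obtain G' where G': "G' \<in> carrier_mat n r" "G * G' = 1\<^sub>m r"
    using exists_right_inverse[OF r(2)] G by auto
  have "F * G * (G' * F') * (F * G) = F * (G * G') * (F' * F) * G"
    using F G F'(1) G'(1) by (simp add: mult_mat_assoc)
  also have "\<dots> = A"
    using F G F' G' FG by simp
  finally have "G' * F' \<in> ginverses A"
    using F'(1) G'(1) unfolding FG ginverses_def m_def n_def by simp
  then show ?thesis by blast
qed

text \<open>If \<open>A = F * G\<close> is a full rank factorization, then \<open>A * Q = F * (G * Q)\<close> forces \<open>G * Q\<close> to have full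
  row rank. So \<open>F\<close>, and with it \<open>A\<close>, can be recovered from \<open>A * Q\<close> by multiplying with a right
  inverse of \<open>G * Q\<close>.\<close>

lemma rank_preserving_imp_right_factor:
  assumes Q: "dim_col A = dim_row Q" and rank: "mat_rank (A * Q) = mat_rank A"
  shows "\<exists>Y \<in> carrier_mat (dim_col Q) (dim_col A). A = A * Q * Y"
proof -
  define r m n where "r = mat_rank A" and "m = dim_row A" and "n = dim_col A"
  obtain F G where F: "F \<in> carrier_mat m r" and G: "G \<in> carrier_mat r n" and FG: "F * G = A"
    using mat_rank_factorization[of A] unfolding r_def m_def n_def by metis
  have dims: "dim_row F = m" "dim_col F = r" "dim_row G = r" "dim_col G = n" "dim_row Q = n"
    using F G Q n_def by auto
  have eq: "A * Q = F * (G * Q)"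
    unfolding FG[symmetric] by (intro mult_mat_assoc) (simp_all add: dims)
  then have "r \<le> mat_rank (G * Q)"
    using mat_rank_mult_le_right[of F "G * Q"] rank r_def by (simp add: dims)
  moreover have "mat_rank (G * Q) \<le> r"
    using mat_rank_mult_le_inner_dim[of "1\<^sub>m r" "G * Q"] dims by simp
  ultimately have "mat_rank (G * Q) = dim_row (G * Q)"
    using G by simp
  then obtain Z where Z: "Z \<in> carrier_mat (dim_col Q) r" "G * Q * Z = 1\<^sub>m r"
    using exists_right_inverse[of "G * Q"] by (auto simp: dims)
  have "A * Q * (Z * G) = F * (G * Q * Z) * G"
    unfolding eq using Z(1) by (simp add: mult_mat_assoc dims)
  also have "\<dots> = A"
    using F Z(2) FG by simp
  finally show ?thesis
    using Z(1) G n_def by (intro bexI[of _ "Z * G"]) auto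
qed

lemma rank_preserving_imp_left_factor:
  assumes P: "dim_col P = dim_row A" and rank: "mat_rank (P * A) = mat_rank A"
  shows "\<exists>X \<in> carrier_mat (dim_row A) (dim_row P). A = X * (P * A)"
proof -
  obtain Y where Y: "Y \<in> carrier_mat (dim_row P) (dim_row A)"
      and eq: "transpose_mat A = transpose_mat A * transpose_mat P * Y"
    using rank_preserving_imp_right_factor[of "transpose_mat A" "transpose_mat P"]
      mat_rank_transpose[of A] mat_rank_transpose[of "P * A"] P rank transpose_mult_dim[OF P]
    by auto
  have "A = transpose_mat (transpose_mat A * transpose_mat P * Y)"
    by (simp only: eq[symmetric] transpose_transpose)
  also have "\<dots> = transpose_mat (transpose_mat (P * A) * Y)"
    using P by (simp add: transpose_mult_dim)
  also have "\<dots> = transpose_mat Y * (P * A)"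
    using Y P by (subst transpose_mult_dim) auto
  finally show ?thesis using Y by (intro bexI[of _ "transpose_mat Y"]) auto
qed

section \<open>Equivalent conditions for spanning rows and columns\<close>

text \<open>For a CUR decomposition, \<open>P\<close> consists of rows and \<open>Q\<close> of columns of an identity matrix, so that
  \<open>P * A\<close> and \<open>A * Q\<close> consist of the chosen rows and columns of \<open>A\<close>.\<close>

locale cur_selection =
  fixes A P Q :: "'a::field mat" and m n k l :: nat
  assumes A: "A \<in> carrier_mat m n" and P: "P \<in> carrier_mat k m" and Q: "Q \<in> carrier_mat n l"
begin

abbreviation "C \<equiv> A * Q"
abbreviation "R \<equiv> P * A"
abbreviation "U \<equiv> P * A * Q"

definition spanning :: bool where
  "spanning \<longleftrightarrow> (\<exists>Y \<in> carrier_mat l n. A = C * Y) \<and> (\<exists>X \<in> carrier_mat m k. A = X * R)"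

lemma dims [simp]:
  "dim_row A = m" "dim_col A = n" "dim_row P = k" "dim_col P = m" "dim_row Q = n" "dim_col Q = l"
  using A P Q by auto

lemma ginverses_dims:
  "K \<in> ginverses C \<Longrightarrow> dim_row K = l \<and> dim_col K = m"
  "L \<in> ginverses R \<Longrightarrow> dim_row L = n \<and> dim_col L = k"
  "G \<in> ginverses U \<Longrightarrow> dim_row G = l \<and> dim_col G = k"
  by (auto simp: ginverses_def)

lemma spanning_imp_core_factor:
  assumes spanning
  obtains X Y where "X \<in> carrier_mat m k" "Y \<in> carrier_mat l n" "X * R = A" "C * Y = A" "X * U * Y = A"
proof -
  obtain X Y where XY: "X \<in> carrier_mat m k" "Y \<in> carrier_mat l n" "X * R = A" "C * Y = A"
    using assms unfolding spanning_def by metis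
  have "X * U * Y = X * R * (Q * Y)"
    using XY(1,2) by (simp add: mult_mat_assoc)
  also have "\<dots> = A * (Q * Y)"
    using XY(3) by simp
  also have "\<dots> = A"
    using XY(2,4) by (simp add: mult_mat_assoc)
  finally show ?thesis
    using XY that by simp
qed

lemma rank_le:
  "mat_rank C \<le> mat_rank A" "mat_rank R \<le> mat_rank A"
  "mat_rank U \<le> mat_rank C" "mat_rank U \<le> mat_rank R"
  using mat_rank_mult_le_left[of A Q] mat_rank_mult_le_right[of P A]
    mat_rank_mult_le_right[of P C] mat_rank_mult_le_left[of R Q]
  by (simp_all add: mult_mat_assoc)

lemma rank_CR_iff: "mat_rank C = mat_rank A \<and> mat_rank R = mat_rank A \<longleftrightarrow> spanning"
proof
  assume "mat_rank C = mat_rank A \<and> mat_rank R = mat_rank A"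
  then show spanning
    using rank_preserving_imp_right_factor[of A Q] rank_preserving_imp_left_factor[of P A]
    unfolding spanning_def by simp
next
  assume spanning
  then obtain X Y where XY: "X \<in> carrier_mat m k" "Y \<in> carrier_mat l n" "X * R = A" "C * Y = A"
    unfolding spanning_def by metis
  have "mat_rank (C * Y) \<le> mat_rank C" "mat_rank (X * R) \<le> mat_rank R"
    using XY(1,2) mat_rank_mult_le_left[of C Y] mat_rank_mult_le_right[of X R] by simp_all
  then have "mat_rank A \<le> mat_rank C" "mat_rank A \<le> mat_rank R"
    using XY(3,4) by simp_all
  then show "mat_rank C = mat_rank A \<and> mat_rank R = mat_rank A"
    using rank_le by simp
qed

text \<open>The rank of \<open>U\<close> is squeezed: it is at most the ranks of \<open>C\<close> and \<open>R\<close>, which are at most the rank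
  of \<open>A\<close>, while \<open>A = X * U * Y\<close> gives the opposite inequality.\<close>

lemma rank_U_iff: "mat_rank U = mat_rank A \<longleftrightarrow> spanning"
proof
  assume "mat_rank U = mat_rank A"
  then show spanning
    using rank_le by (simp flip: rank_CR_iff)
next
  assume spanning
  then obtain X Y where XY: "X \<in> carrier_mat m k" "Y \<in> carrier_mat l n" "X * U * Y = A"
    by (rule spanning_imp_core_factor)
  have "mat_rank (X * U * Y) \<le> mat_rank (X * U)" "mat_rank (X * U) \<le> mat_rank U"
    using XY(1,2) mat_rank_mult_le_left[of "X * U" Y] mat_rank_mult_le_right[of X U] by simp_all
  then have "mat_rank A \<le> mat_rank U"
    using XY(3) by simp
  then show "mat_rank U = mat_rank A"
    using rank_le by simp
qed

lemma spanning_imp_CUR: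
  assumes spanning and G: "G \<in> ginverses U"
  shows "A = C * G * R"
proof -
  obtain X Y where XY: "X \<in> carrier_mat m k" "Y \<in> carrier_mat l n" "X * R = A" "C * Y = A" "X * U * Y = A"
    using assms(1) by (rule spanning_imp_core_factor)
  have "C * G * R = (X * R * Q) * G * (P * (C * Y))"
    unfolding XY(3,4) ..
  also have "\<dots> = X * (U * G * U) * Y"
    using XY(1,2) ginverses_dims(3)[OF G] by (simp add: mult_mat_assoc)
  also have "\<dots> = A"
    using G XY(5) by (simp add: ginverses_def)
  finally show ?thesis ..
qed

lemma factorization_imp_spanning:
  assumes "dim_row M = l" "dim_col M = k" "C * M * R = A"
  shows spanning
  unfolding spanning_def
proof
  show "\<exists>Y \<in> carrier_mat l n. A = C * Y"
    using assms by (intro bexI[of _ "M * R"]) (auto simp: mult_mat_assoc[symmetric])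
  show "\<exists>X \<in> carrier_mat m k. A = X * R"
    using assms by (intro bexI[of _ "C * M"]) auto
qed

lemma spanning_imp_projections:
  assumes spanning
  shows "K \<in> ginverses C \<Longrightarrow> C * K * A = A" "L \<in> ginverses R \<Longrightarrow> A * L * R = A"
proof -
  obtain X Y where XY: "X \<in> carrier_mat m k" "Y \<in> carrier_mat l n" "X * R = A" "C * Y = A"
    using assms unfolding spanning_def by metis
  show "C * K * A = A" if K: "K \<in> ginverses C"
  proof -
    have "C * K * A = C * K * (C * Y)"
      using XY(4) by simp
    also have "\<dots> = C * K * C * Y"
      using XY(2) ginverses_dims(1)[OF K] by (simp add: mult_mat_assoc)
    also have "\<dots> = A"
      using K XY(4) by (simp add: ginverses_def)
    finally show ?thesis .
  qed
  show "A * L * R = A" if L: "L \<in> ginverses R"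
  proof -
    have "A * L * R = X * R * L * R"
      using XY(3) by simp
    also have "\<dots> = X * (R * L * R)"
      using XY(1) ginverses_dims(2)[OF L] by (simp add: mult_mat_assoc)
    also have "\<dots> = A"
      using L XY(3) by (simp add: ginverses_def)
    finally show ?thesis .
  qed
qed

context
  fixes K L
  assumes spanning: spanning and K: "K \<in> ginverses C" and L: "L \<in> ginverses R"
begin

lemma double_projection: "C * K * A * L * R = A"
  using spanning_imp_projections[OF spanning] K L by simp

lemma mult_LUK: "A * (L * U * K) = C * K"
proof -
  have "A * (L * U * K) = A * L * R * (Q * K)"
    using ginverses_dims(1)[OF K] ginverses_dims(2)[OF L] by (simp add: mult_mat_assoc)
  also have "\<dots> = C * K"
    using spanning_imp_projections(2)[OF spanning L] ginverses_dims(1)[OF K]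
    by (simp add: mult_mat_assoc)
  finally show ?thesis .
qed

lemma LUK_mult: "L * U * K * A = L * R"
proof -
  have "L * U * K * A = L * (P * (C * K * A))"
    using ginverses_dims(1)[OF K] ginverses_dims(2)[OF L] by (simp add: mult_mat_assoc)
  also have "\<dots> = L * R"
    using spanning_imp_projections(1)[OF spanning K] by simp
  finally show ?thesis .
qed

lemma LUK_outer: "A * (L * U * K) * A = A"
  using mult_LUK spanning_imp_projections(1)[OF spanning K] by simp

lemma LUK_inner: "L * U * K * A * (L * U * K) = L * U * K"
proof -
  have "L * U * K * A * (L * U * K) = L * R * (L * U * K)"
    using LUK_mult by simp
  also have "\<dots> = L * (R * L * R) * (Q * K)"
    using ginverses_dims(1)[OF K] ginverses_dims(2)[OF L] by (simp add: mult_mat_assoc)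
  also have "\<dots> = L * R * (Q * K)"
    using L by (simp add: ginverses_def)
  also have "\<dots> = L * U * K"
    using ginverses_dims(1)[OF K] ginverses_dims(2)[OF L] by (simp add: mult_mat_assoc)
  finally show ?thesis .
qed

lemma LUK_in_ginverses: "L * U * K \<in> ginverses A"
  using LUK_outer ginverses_dims(1)[OF K] ginverses_dims(2)[OF L] by (auto simp: ginverses_def)

end

lemma double_projection_imp_spanning:
  assumes K: "K \<in> ginverses C" and L: "L \<in> ginverses R" and eq: "A = C * K * A * L * R"
  shows spanning
proof (rule factorization_imp_spanning)
  have "C * (K * A * L) * R = C * K * A * L * R"
    using ginverses_dims(1)[OF K] ginverses_dims(2)[OF L] by (simp add: mult_mat_assoc)
  then show "C * (K * A * L) * R = A"
    by (simp only: eq[symmetric])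
qed (use ginverses_dims(1)[OF K] ginverses_dims(2)[OF L] in auto)

text \<open>Here the factorization \<open>A = A * L * U * K * A\<close> neither begins with \<open>C\<close> nor ends with \<open>R\<close>, but it
  bounds the rank of \<open>A\<close> by that of \<open>U\<close>.\<close>

lemma LUK_in_ginverses_imp_spanning:
  assumes K: "K \<in> ginverses C" and L: "L \<in> ginverses R" and g: "L * U * K \<in> ginverses A"
  shows spanning
proof -
  have "A = A * (L * U * K) * A"
    using g by (simp add: ginverses_def)
  also have "\<dots> = A * L * (U * (K * A))"
    using ginverses_dims(1)[OF K] ginverses_dims(2)[OF L] by (simp add: mult_mat_assoc)
  finally have "mat_rank A \<le> mat_rank (U * (K * A))"
    using mat_rank_mult_le_right[of "A * L" "U * (K * A)"] ginverses_dims(2)[OF L] by simp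
  also have "\<dots> \<le> mat_rank U"
    using mat_rank_mult_le_left[of U "K * A"] ginverses_dims(1)[OF K] by simp
  finally show ?thesis
    using rank_le rank_U_iff by simp
qed

lemma CUR_iff:
  "(\<exists>G \<in> ginverses U. A = C * G * R) \<longleftrightarrow> spanning"
  "(\<forall>G \<in> ginverses U. A = C * G * R) \<longleftrightarrow> spanning"
  using spanning_imp_CUR factorization_imp_spanning[OF _ _ sym] ginverses_dims(3)
    ginverses_nonempty[of U]
  by blast+

lemma double_projection_iff:
  "(\<exists>K \<in> ginverses C. \<exists>L \<in> ginverses R. A = C * K * A * L * R) \<longleftrightarrow> spanning"
  "(\<forall>K \<in> ginverses C. \<forall>L \<in> ginverses R. A = C * K * A * L * R) \<longleftrightarrow> spanning"
  using double_projection[symmetric] double_projection_imp_spanning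
    ginverses_nonempty[of C] ginverses_nonempty[of R]
  by blast+

lemma LUK_in_ginverses_iff:
  "(\<exists>K \<in> ginverses C. \<exists>L \<in> ginverses R. L * U * K \<in> ginverses A) \<longleftrightarrow> spanning"
  "(\<forall>K \<in> ginverses C. \<forall>L \<in> ginverses R. L * U * K \<in> ginverses A) \<longleftrightarrow> spanning"
  using LUK_in_ginverses LUK_in_ginverses_imp_spanning ginverses_nonempty[of C] ginverses_nonempty[of R]
  by blast+

end

section \<open>Submatrices as products with selection matrices\<close>

lemma submatrix_mult:
  assumes "dim_col X = dim_row Y"
  shows "submatrix (X * Y) I J = submatrix X I UNIV * submatrix Y UNIV J"
proof (rule eq_matI)
  fix i j assume "i < dim_row (submatrix X I UNIV * submatrix Y UNIV J)"
    "j < dim_col (submatrix X I UNIV * submatrix Y UNIV J)"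
  then have ij: "i < card {i. i < dim_row X \<and> i \<in> I}" "j < card {j. j < dim_col Y \<and> j \<in> J}"
    by (simp_all add: dim_submatrix)
  then have p: "pick I i < dim_row X" "pick J j < dim_col Y"
    by (simp_all add: pick_le)
  show "submatrix (X * Y) I J $$ (i, j) = (submatrix X I UNIV * submatrix Y UNIV J) $$ (i, j)"
    using ij p assms by (simp add: submatrix_def scalar_prod_def pick_UNIV)
qed (simp_all add: dim_submatrix)

lemma submatrix_UNIV: "submatrix A UNIV UNIV = A"
  by (rule eq_matI) (simp_all add: submatrix_def pick_UNIV)

lemma submatrix_submatrix_rows: "submatrix (submatrix A UNIV J) I UNIV = submatrix A I J"
  by (rule submatrix_split[symmetric])

lemma submatrix_submatrix_cols: "submatrix (submatrix A I UNIV) UNIV J = submatrix A I J"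
proof (rule eq_matI)
  fix i j assume "i < dim_row (submatrix A I J)" "j < dim_col (submatrix A I J)"
  then have "i < card {i. i < dim_row A \<and> i \<in> I}" "j < card {j. j < dim_col A \<and> j \<in> J}"
    by (simp_all add: dim_submatrix)
  then show "submatrix (submatrix A I UNIV) UNIV J $$ (i, j) = submatrix A I J $$ (i, j)"
    by (simp add: submatrix_def pick_UNIV pick_le)
qed (simp_all add: dim_submatrix)

lemma eq_mat_iff_blocks:
  assumes A: "A \<in> carrier_mat m n" and B: "B \<in> carrier_mat m n"
  shows "A = B \<longleftrightarrow> submatrix A I J = submatrix B I J
    \<and> submatrix A I ({..<n} - J) = submatrix B I ({..<n} - J)
    \<and> submatrix A ({..<m} - I) J = submatrix B ({..<m} - I) J
    \<and> submatrix A ({..<m} - I) ({..<n} - J) = submatrix B ({..<m} - I) ({..<n} - J)"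
    (is "_ \<longleftrightarrow> ?blocks")
proof
  assume blocks: ?blocks
  show "A = B"
  proof (rule eq_matI)
    fix i j assume "i < dim_row B" "j < dim_col B"
    then have ij: "i < m" "j < n" using B by auto
    define I' where "I' = (if i \<in> I then I else {..<m} - I)"
    define J' where "J' = (if j \<in> J then J else {..<n} - J)"
    have mem: "i \<in> I'" "j \<in> J'" using ij by (auto simp: I'_def J'_def)
    have "submatrix A I' J' = submatrix B I' J'"
      using blocks by (simp add: I'_def J'_def)
    then show "A $$ (i, j) = B $$ (i, j)"
      using submatrix_index_card[of i A j I' J'] submatrix_index_card[of i B j I' J'] mem ij A B
      by (simp add: carrier_matD)
  qed (use A B in auto)
qed simp

lemma minus_mat_eq_0_iff:
  fixes X Y :: "'a::group_add mat"
  assumes "X \<in> carrier_mat r c" "Y \<in> carrier_mat r c"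
  shows "X - Y = 0\<^sub>m r c \<longleftrightarrow> X = Y"
  using assms by (auto simp: mat_eq_iff)

text \<open>Each block of \<open>C * G * R\<close> is the product of a block of \<open>C\<close>, the matrix \<open>G\<close> and a block of \<open>R\<close>.
  So \<open>A = C * G * R\<close> amounts to four equations, of which the one for \<open>U\<close> says that \<open>G\<close> is a
  generalized inverse and the other three are the ones for \<open>B\<close>, \<open>D\<close> and \<open>E\<close> in the block
  condition.\<close>

lemma schur_iff_CUR:
  fixes A :: "'a::field mat"
  assumes A: "A \<in> carrier_mat m n" and G: "G \<in> ginverses (submatrix A I J)"
  defines "Ic \<equiv> {..<m} - I" and "Jc \<equiv> {..<n} - J"
  defines "U \<equiv> submatrix A I J" and "B \<equiv> submatrix A I Jc"
    and "D \<equiv> submatrix A Ic J" and "E \<equiv> submatrix A Ic Jc"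
  shows "E - D * G * B = 0\<^sub>m (dim_row E) (dim_col E)
      \<and> D * (1\<^sub>m (dim_col U) - G * U) = 0\<^sub>m (dim_row D) (dim_col D)
      \<and> (1\<^sub>m (dim_row U) - U * G) * B = 0\<^sub>m (dim_row B) (dim_col B)
    \<longleftrightarrow> A = submatrix A UNIV J * G * submatrix A I UNIV"
proof -
  define k l k' l' where "k = dim_row U" and "l = dim_col U"
    and "k' = dim_row E" and "l' = dim_col E"
  have U: "U \<in> carrier_mat k l" and B: "B \<in> carrier_mat k l'"
    and D: "D \<in> carrier_mat k' l" and E: "E \<in> carrier_mat k' l'"
    unfolding k_def l_def k'_def l'_def U_def B_def D_def E_def
    by (auto simp: dim_submatrix intro!: carrier_matI)
  have G': "G \<in> carrier_mat l k" and UGU: "U * G * U = U"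
    using G by (auto simp: ginverses_def U_def k_def l_def)
  define Z where "Z = submatrix A UNIV J * G * submatrix A I UNIV"
  have C: "submatrix A UNIV J \<in> carrier_mat m l" and R: "submatrix A I UNIV \<in> carrier_mat k n"
    using A unfolding k_def l_def U_def by (auto simp: dim_submatrix intro!: carrier_matI)
  have Z: "Z \<in> carrier_mat m n"
    using C R G' by (simp add: Z_def)
  have block: "submatrix Z I' J' = submatrix A I' J * G * submatrix A I J'" for I' J'
  proof -
    have "submatrix Z I' J' = submatrix (submatrix A UNIV J * G) I' UNIV * submatrix A I J'"
      unfolding Z_def using C R G'
      by (subst submatrix_mult) (simp_all add: submatrix_submatrix_cols)
    also have "submatrix (submatrix A UNIV J * G) I' UNIV = submatrix A I' J * G"
      using C G' by (subst submatrix_mult) (simp_all add: submatrix_submatrix_rows submatrix_UNIV)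
    finally show ?thesis .
  qed
  have "A = Z \<longleftrightarrow> U = U * G * U \<and> B = U * G * B \<and> D = D * G * U \<and> E = D * G * B"
    using eq_mat_iff_blocks[OF A Z, of I J]
    by (simp add: block U_def B_def D_def E_def Ic_def Jc_def)
  moreover have "D * (1\<^sub>m l - G * U) = D - D * G * U"
    using D G' U by (simp add: mult_minus_distrib_mat[of _ k' l _ l])
  moreover have "(1\<^sub>m k - U * G) * B = B - U * G * B"
    using B G' U by (simp add: minus_mult_distrib_mat[of _ k k])
  ultimately show ?thesis
    using U B D E G' UGU minus_mat_eq_0_iff[of E k' l' "D * G * B"]
      minus_mat_eq_0_iff[of D k' l "D * G * U"] minus_mat_eq_0_iff[of B k l' "U * G * B"]
    unfolding Z_def by auto
qed

lemma submatrix_eq_selection: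
  fixes A :: "'a::field mat" and I J :: "nat set"
  assumes A: "A \<in> carrier_mat m n"
  defines "P \<equiv> submatrix (1\<^sub>m m) I UNIV" and "Q \<equiv> submatrix (1\<^sub>m n) UNIV J"
  shows "cur_selection A P Q m n (dim_row P) (dim_col Q)"
    and "submatrix A UNIV J = A * Q" and "submatrix A I UNIV = P * A" and "submatrix A I J = P * A * Q"
proof -
  have PQ: "dim_col P = m" "dim_row Q = n"
    by (simp_all add: P_def Q_def dim_submatrix)
  then show "cur_selection A P Q m n (dim_row P) (dim_col Q)"
    using A by unfold_locales auto
  have "submatrix (A * 1\<^sub>m n) I' J = submatrix A I' UNIV * Q" for I'
    using A by (subst submatrix_mult) (auto simp: Q_def)
  then have cols: "submatrix A I' J = submatrix A I' UNIV * Q" for I'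
    using A by simp
  have "submatrix (1\<^sub>m m * A) I UNIV = P * submatrix A UNIV UNIV"
    using A by (subst submatrix_mult) (auto simp: P_def)
  then show rows: "submatrix A I UNIV = P * A"
    using A by (simp add: submatrix_UNIV)
  show "submatrix A UNIV J = A * Q"
    using cols[of UNIV] by (simp add: submatrix_UNIV)
  show "submatrix A I J = P * A * Q"
    using cols[of I] rows by simp
qed

section \<open>The conditions on submatrices and the resulting inverse\<close>

lemma cur_conditions_iff:
  fixes A :: "'a::field mat"
  assumes A: "A \<in> carrier_mat m n" and p: "p \<in> set (cur_conditions A I J)"
  defines "P \<equiv> submatrix (1\<^sub>m m) I UNIV" and "Q \<equiv> submatrix (1\<^sub>m n) UNIV J"
  shows "p \<longleftrightarrow> cur_selection.spanning A P Q m n (dim_row P) (dim_col Q)"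
proof -
  note sel = submatrix_eq_selection(1,4)[OF A, of I J, folded P_def Q_def]
    submatrix_eq_selection(2)[OF A, of J, folded Q_def]
    submatrix_eq_selection(3)[OF A, of I, folded P_def]
  interpret cur_selection A P Q m n "dim_row P" "dim_col Q" by (rule sel(1))
  have mn: "dim_row A = m" "dim_col A = n" using A by auto
  note schur = schur_iff_CUR[OF A, of _ I J]
  show ?thesis
    using p rank_U_iff rank_CR_iff CUR_iff double_projection_iff LUK_in_ginverses_iff
    unfolding cur_conditions_def Let_def mn
    (* The block condition is recognizable only before submatrices are replaced by products. *)
    by (simp only: schur list.set insert_iff empty_iff cong: bex_cong ball_cong,
        simp only: sel(2-4), metis)
qed

text \<open>The last two equations settle the symmetry claims at once, whatever the operation \<open>*\<close> is, as they
  identify the products of the inverse with \<open>A\<close> as \<open>C * K\<close> and \<open>L * R\<close>.\<close>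

lemma cur_inverse:
  fixes A :: "'a::field mat"
  assumes A: "A \<in> carrier_mat m n" and cond: "\<exists>p \<in> set (cur_conditions A I J). p"
    and K: "K \<in> ginverses (submatrix A UNIV J)" and L: "L \<in> ginverses (submatrix A I UNIV)"
  defines "X \<equiv> L * submatrix A I J * K"
  shows "A * X * A = A" and "X * A * X = X"
    and "A * X = submatrix A UNIV J * K" and "X * A = L * submatrix A I UNIV"
proof -
  define P Q where "P = submatrix (1\<^sub>m m :: 'a mat) I UNIV" and "Q = submatrix (1\<^sub>m n :: 'a mat) UNIV J"
  note sel = submatrix_eq_selection(1,4)[OF A, of I J, folded P_def Q_def]
    submatrix_eq_selection(2)[OF A, of J, folded Q_def]
    submatrix_eq_selection(3)[OF A, of I, folded P_def]
  interpret cur_selection A P Q m n "dim_row P" "dim_col Q" by (rule sel(1))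
  have spanning
    using cond cur_conditions_iff[OF A, of _ I J] unfolding P_def Q_def by blast
  note KL = this K[unfolded sel] L[unfolded sel]
  show "A * X * A = A" "X * A * X = X" "A * X = submatrix A UNIV J * K" "X * A = L * submatrix A I UNIV"
    unfolding X_def sel by (fact LUK_outer[OF KL] LUK_inner[OF KL] mult_LUK[OF KL] LUK_mult[OF KL])+
qed

theorem theorem3p6:
  fixes A :: "'a::field mat" and H :: "complex mat"
    and m n :: nat and I J :: "nat set"
  assumes "A \<in> carrier_mat m n" and "H \<in> carrier_mat m n"
    and "I \<subseteq> {..<m}" and "J \<subseteq> {..<n}"
  shows
    "(\<forall>p \<in> set (cur_conditions A I J). \<forall>q \<in> set (cur_conditions A I J). p \<longleftrightarrow> q)
   \<and> ((\<exists>p \<in> set (cur_conditions A I J). p) \<longrightarrow>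
       (let C = submatrix A UNIV J; R = submatrix A I UNIV; U = submatrix A I J in
         (\<forall>K \<in> ginverses C. \<forall>L \<in> ginverses R. let X = L * U * K in
            A * X * A = A \<and> X * A * X = X)
       \<and> (\<forall>K \<in> ginverses C. transpose_mat (C * K) = C * K \<longrightarrow>
            (\<forall>L \<in> ginverses R. let X = L * U * K in transpose_mat (A * X) = A * X))
       \<and> (\<forall>L \<in> ginverses R. transpose_mat (L * R) = L * R \<longrightarrow>
            (\<forall>K \<in> ginverses C. let X = L * U * K in transpose_mat (X * A) = X * A))))
   \<and> ((\<exists>p \<in> set (cur_conditions H I J). p) \<longrightarrow>
       (let C = submatrix H UNIV J; R = submatrix H I UNIV; U = submatrix H I J in
         (\<forall>K \<in> ginverses C. \<forall>L \<in> ginverses R. let X = L * U * K in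
            H * X * H = H \<and> X * H * X = X)
       \<and> (\<forall>K \<in> ginverses C. mat_adjoint (C * K) = C * K \<longrightarrow>
            (\<forall>L \<in> ginverses R. let X = L * U * K in mat_adjoint (H * X) = H * X))
       \<and> (\<forall>L \<in> ginverses R. mat_adjoint (L * R) = L * R \<longrightarrow>
            (\<forall>K \<in> ginverses C. let X = L * U * K in mat_adjoint (X * H) = X * H))))"
proof (intro conjI)
  show "\<forall>p \<in> set (cur_conditions A I J). \<forall>q \<in> set (cur_conditions A I J). p \<longleftrightarrow> q"
    using cur_conditions_iff[OF assms(1), of _ I J] by blast
qed (use cur_inverse[OF assms(1), of I J] cur_inverse[OF assms(2), of I J] in
    \<open>simp_all add: Let_def\<close>)

end
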